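(* Let $Y$ be a matrix chaos of combinatorial type of order $q$ with $p$ summation indices, with dimensions $S_1,\dots,S_p$ and ordered subsets $I_1,\dots,I_{q+2}$ of $[p]$. Let $R,C\subseteq[q+2]$, and let $\mathcal R=\bigcup_{t\in R}I_t$ and $\mathcal C=\bigcup_{t\in C}I_t$ (as subsets of $[p]$). Then $$\big\|\mathcal A_{[R|C]}\big\|^2=\Big(\prod_{u\in\mathcal R^c}S_u\Big)\Big(\prod_{u\in\mathcal C^c}S_u\Big),$$ where complements are taken in $[p]$.
   Context: Let $q,p,S_1,\dots,S_p$ be positive integers and $I_1,\dots,I_{q+2}$ ordered subsets of $[p]=\{1,\dots,p\}$. For $I=(i_1,\dots,i_k)$ and $\mathbf s=(s_1,\dots,s_p)$ write $I(\mathbf s)=(s_{i_1},\dots,s_{i_k})$ and $e_{I(\mathbf s)}=e_{s_{i_1}}\otimes\cdots\otimes e_{s_{i_k}}$, where $e_s$ (for $s\in[S_u]$) denotes a standard basis column vector of $\mathbb R^{S_u}$. A matrix chaos of combinatorial type is $$Y=\sum_{\mathbf s\in[S_1]\times\cdots\times[S_p]}h^{(1)}_{I_1(\mathbf s)}\cdots h^{(q)}_{I_q(\mathbf s)}\;e_{I_{q+1}(\mathbf s)}\otimes e_{I_{q+2}(\mathbf s)}^\top,$$ where the $h^{(t)}_{\bullet}$ are independent copies of a zero-mean scalar random variable $h$. Flattenings: $\mathcal A$ is the order-$(q+2)$ coefficient tensor of $Y$, and for $R,C\subseteq[q+2]$ its flattening is the matrix $$\mathcal A_{[R|C]}=\sum_{\mathbf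 s\in[S_1]\times\cdots\times[S_p]}\Big(\bigotimes_{t\in R}e_{I_t(\mathbf s)}\Big)\otimes\Big(\bigotimes_{t\in C}e_{I_t(\mathbf s)}^\top\Big)$$ (empty tensor products are the scalar $1$). $\|\cdot\|$ is the operator (spectral) norm. *)

theory Defs
  imports "HOL-Probability.Probability" "Jordan_Normal_Form.Matrix"
begin

text \<open>Column vectors of dimension \<open>n\<close> are \<open>n \<times> 1\<close> matrices, so that a single Kronecker product
  serves for all tensor products, including those of columns with rows.\<close>

definition kron :: "real mat \<Rightarrow> real mat \<Rightarrow> real mat"  (infixl "\<otimes>\<^sub>K" 72) where
  "A \<otimes>\<^sub>K B = mat (dim_row A * dim_row B) (dim_col A * dim_col B)
     (\<lambda>(i, j). A $$ (i div dim_row B, j div dim_col B) * B $$ (i mod dim_row B, j mod dim_col B))"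

definition kron_list :: "real mat list \<Rightarrow> real mat" where
  "kron_list As = foldr (\<otimes>\<^sub>K) As (1\<^sub>m 1)"

text \<open>Coordinates are numbered from 1 below, but from 0 in the type of vectors: for
  \<open>s \<in> {1..n}\<close>, \<open>basis_col n s\<close> is the \<open>s\<close>-th standard basis column vector.\<close>

definition basis_col :: "nat \<Rightarrow> nat \<Rightarrow> real mat" where
  "basis_col n s = mat_of_cols n [unit_vec n (s - 1)]"

text \<open>An ordered subset \<open>(i\<^sub>1, \<dots>, i\<^sub>k)\<close> of \<open>{1..p}\<close> is a distinct list \<open>J\<close>; then \<open>J(s)\<close> is \<open>map s J\<close>.
  The vector \<open>basis_tensor S J s\<close> is \<open>e\<close> with index \<open>J(s)\<close>.\<close>

definition basis_tensor :: "(nat \<Rightarrow> nat) \<Rightarrow> nat list \<Rightarrow> (nat \<Rightarrow> nat) \<Rightarrow> real mat" where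
  "basis_tensor S J s = kron_list (map (\<lambda>i. basis_col (S i) (s i)) J)"

definition multi_indices :: "nat \<Rightarrow> (nat \<Rightarrow> nat) \<Rightarrow> (nat \<Rightarrow> nat) set" where
  "multi_indices p S = (\<Pi>\<^sub>E u\<in>{1..p}. {1..S u})"

text \<open>The dimensions are explicit since matrices of all sizes share one type; every \<open>f x\<close> is meant
  to be an \<open>m \<times> n\<close> matrix.\<close>

definition mat_sum :: "nat \<Rightarrow> nat \<Rightarrow> ('a \<Rightarrow> real mat) \<Rightarrow> 'a set \<Rightarrow> real mat" where
  "mat_sum m n f X = mat m n (\<lambda>ij. \<Sum>x\<in>X. f x $$ ij)"

definition tuple_dim :: "(nat \<Rightarrow> nat) \<Rightarrow> nat list \<Rightarrow> nat" where
  "tuple_dim S J = prod_list (map S J)"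

definition combinatorial_data ::
  "nat \<Rightarrow> nat \<Rightarrow> (nat \<Rightarrow> nat) \<Rightarrow> (nat \<Rightarrow> nat list) \<Rightarrow> bool" where
  "combinatorial_data q p S I \<longleftrightarrow>
     0 < q \<and> 0 < p \<and> (\<forall>u\<in>{1..p}. 0 < S u) \<and>
     (\<forall>t\<in>{1..q + 2}. distinct (I t) \<and> set (I t) \<subseteq> {1..p})"

definition independent_copies ::
  "'w measure \<Rightarrow> ('w \<Rightarrow> real) \<Rightarrow> ('i \<Rightarrow> 'w \<Rightarrow> real) \<Rightarrow> 'i set \<Rightarrow> bool" where
  "independent_copies M \<xi> X J \<longleftrightarrow>
     prob_space.indep_vars M (\<lambda>_. borel) X J \<and>
     (\<forall>j\<in>J. distr M borel (X j) = distr M borel \<xi>)"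

text \<open>\<open>h t l\<close> is the variable with superscript \<open>t\<close> and subscript the tuple \<open>l\<close>. All these
  variables, for all pairs \<open>(t, l)\<close> together, are independent and have the law of \<open>\<xi>\<close>.\<close>

definition matrix_chaos_comb ::
  "'w measure \<Rightarrow> ('w \<Rightarrow> real) \<Rightarrow> (nat \<Rightarrow> nat list \<Rightarrow> 'w \<Rightarrow> real) \<Rightarrow>
   nat \<Rightarrow> nat \<Rightarrow> (nat \<Rightarrow> nat) \<Rightarrow> (nat \<Rightarrow> nat list) \<Rightarrow> ('w \<Rightarrow> real mat) \<Rightarrow> bool" where
  "matrix_chaos_comb M \<xi> h q p S I Y \<longleftrightarrow>
     combinatorial_data q p S I \<and>
     prob_space M \<and> integrable M \<xi> \<and> integral\<^sup>L M \<xi> = 0 \<and>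
     independent_copies M \<xi> (\<lambda>(t, l). h t l)
       (SIGMA t:{1..q}. (\<lambda>s. map s (I t)) ` multi_indices p S) \<and>
     (\<forall>\<omega>\<in>space M. Y \<omega> =
        mat_sum (tuple_dim S (I (q + 1))) (tuple_dim S (I (q + 2)))
          (\<lambda>s. (\<Prod>t=1..q. h t (map s (I t)) \<omega>) \<cdot>\<^sub>m
               (basis_tensor S (I (q + 1)) s \<otimes>\<^sub>K transpose_mat (basis_tensor S (I (q + 2)) s)))
          (multi_indices p S))"

text \<open>The coefficient tensor of the chaos is the sum over \<open>s\<close> of the tensor products, over all
  \<open>t \<in> {1..q + 2}\<close>, of \<open>basis_tensor S (I t) s\<close>; its flattening puts the factors with \<open>t \<in> R\<close> on the
  rows and those with \<open>t \<in> C\<close> on the columns. The sets \<open>R\<close> and \<open>C\<close> may overlap and need not cover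
  \<open>{1..q + 2}\<close>. The tensor products over \<open>t \<in> R\<close> and \<open>t \<in> C\<close> are
  taken in increasing order of \<open>t\<close>.\<close>

definition flattening ::
  "nat \<Rightarrow> (nat \<Rightarrow> nat) \<Rightarrow> (nat \<Rightarrow> nat list) \<Rightarrow> nat set \<Rightarrow> nat set \<Rightarrow> real mat" where
  "flattening p S I R C =
     mat_sum (\<Prod>t\<in>R. tuple_dim S (I t)) (\<Prod>t\<in>C. tuple_dim S (I t))
       (\<lambda>s. kron_list (map (\<lambda>t. basis_tensor S (I t) s) (sorted_list_of_set R)) \<otimes>\<^sub>K
            kron_list (map (\<lambda>t. transpose_mat (basis_tensor S (I t) s)) (sorted_list_of_set C)))
       (multi_indices p S)"

definition euclidean_norm :: "real Matrix.vec \<Rightarrow> real" where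
  "euclidean_norm v = sqrt (scalar_prod v v)"

definition spectral_norm :: "real mat \<Rightarrow> real" where
  "spectral_norm A =
     Sup {euclidean_norm (A *\<^sub>v v) | v. v \<in> carrier_vec (dim_col A) \<and> euclidean_norm v \<le> 1}"

end

theory Submission
  imports Defs
begin

text \<open>The flattening is the sum over \<open>s\<close> of the matrix units at \<open>(f s, g s)\<close>, where \<open>f s\<close> and
  \<open>g s\<close> are mixed-radix codes of the coordinates of \<open>s\<close> in \<open>\<R>\<close> and in \<open>\<C>\<close>. All nonempty fibres
  of \<open>f\<close> have the same size \<open>a\<close>, the product of the \<open>S u\<close> over the complement of \<open>\<R>\<close>, and those of
  \<open>g\<close> the same size \<open>b\<close>. Cauchy--Schwarz on each fibre of \<open>f\<close> bounds the squared norm by \<open>a b\<close>,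
  and the indicator vector of the range of \<open>g\<close> attains this bound.\<close>

section \<open>Matrix units with uniform fibres\<close>

lemma euclidean_norm_altdef:
  "euclidean_norm v = sqrt (\<Sum>i<dim_vec v. (vec_index v i)\<^sup>2)"
  unfolding euclidean_norm_def scalar_prod_def
  by (simp add: power2_eq_square atLeast0LessThan)

text \<open>Only nonempty fibres have a prescribed size: different tuples may share indices, so the
  codes need not fill \<open>{..<m}\<close> or \<open>{..<n}\<close>. Entries of \<open>A\<close>
  are multiplicities and can exceed 1.\<close>

lemma spectral_norm_fibres:
  fixes f g :: "'a \<Rightarrow> nat" and X :: "'a set" and a b m n :: nat
  defines "A \<equiv> mat m n (\<lambda>(i, j). \<Sum>s\<in>X. if f s = i \<and> g s = j then 1 else (0::real))"
  assumes fin: "finite X" and ne: "X \<noteq> {}"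
    and f: "\<And>s. s \<in> X \<Longrightarrow> f s < m" and g: "\<And>s. s \<in> X \<Longrightarrow> g s < n"
    and a: "\<And>s. s \<in> X \<Longrightarrow> card {x\<in>X. f x = f s} = a"
    and b: "\<And>s. s \<in> X \<Longrightarrow> card {x\<in>X. g x = g s} = b"
  shows "(spectral_norm A)\<^sup>2 = real (a * b)"
proof -
  have dA: "dim_row A = m" "dim_col A = n" by (auto simp: A_def)
  have Av: "vec_index (A *\<^sub>v v) i = (\<Sum>s\<in>{s\<in>X. f s = i}. vec_index v (g s))"
    if "v \<in> carrier_vec n" "i < m" for v i
  proof -
    have "vec_index (A *\<^sub>v v) i
        = (\<Sum>j<n. (\<Sum>s\<in>X. if f s = i \<and> g s = j then 1 else 0) * vec_index v j)"
      using that by (simp add: A_def scalar_prod_def atLeast0LessThan)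
    also have "\<dots> = (\<Sum>s\<in>X. \<Sum>j<n. if f s = i \<and> g s = j then vec_index v j else 0)"
      by (subst sum.swap) (simp add: sum_distrib_right if_distrib[of "\<lambda>x. x * _"] cong: if_cong)
    also have "\<dots> = (\<Sum>s\<in>X. if f s = i then vec_index v (g s) else 0)"
    proof (intro sum.cong refl)
      fix s assume s: "s \<in> X"
      show "(\<Sum>j<n. if f s = i \<and> g s = j then vec_index v j else 0)
          = (if f s = i then vec_index v (g s) else 0)"
        using g[OF s] by auto
    qed
    also have "\<dots> = (\<Sum>s\<in>{s\<in>X. f s = i}. vec_index v (g s))"
      using fin by (simp add: sum.inter_filter)
    finally show ?thesis .
  qed
  \<comment> \<open>An index outside the range of \<open>k\<close> has an empty fibre, so over all
    indices only an inequality survives.\<close>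
  have fibre_le: "card {s\<in>X. k s = i} \<le> c"
    if "\<And>s. s \<in> X \<Longrightarrow> card {x\<in>X. k x = k s} = c" for c i and k :: "'a \<Rightarrow> nat"
  proof (cases "{s\<in>X. k s = i} = {}")
    case False
    then obtain s where "s \<in> X" "k s = i" by blast
    with that[of s] show ?thesis by simp
  next
    case True
    then show ?thesis by (simp only: card.empty zero_le)
  qed
  have sum_fibres: "(\<Sum>s\<in>X. h (k s)) = (\<Sum>j<l. real (card {s\<in>X. k s = j}) * h j)"
    if "\<And>s. s \<in> X \<Longrightarrow> k s < l" for h :: "nat \<Rightarrow> real" and k l
  proof -
    have "(\<Sum>s\<in>X. h (k s)) = (\<Sum>j<l. \<Sum>s\<in>{s\<in>X. k s = j}. h (k s))"
      using fin that by (intro sum.group[symmetric]) auto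
    then show ?thesis by simp
  qed
  have upper: "(\<Sum>i<m. (vec_index (A *\<^sub>v v) i)\<^sup>2) \<le> a * b * (\<Sum>j<n. (vec_index v j)\<^sup>2)"
    if v: "v \<in> carrier_vec n" for v
  proof -
    have "(\<Sum>i<m. (vec_index (A *\<^sub>v v) i)\<^sup>2)
        \<le> (\<Sum>i<m. a * (\<Sum>s\<in>{s\<in>X. f s = i}. (vec_index v (g s))\<^sup>2))"
    proof (intro sum_mono)
      fix i assume "i \<in> {..<m}"
      \<comment> \<open>The factor 1 prepares Cauchy-Schwarz against the constant family, whose
        squared norm is the size of the fibre.\<close>
      then have "(vec_index (A *\<^sub>v v) i)\<^sup>2 = (\<Sum>s\<in>{s\<in>X. f s = i}. 1 * vec_index v (g s))\<^sup>2"
        using Av[OF v] by simp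
      also have "\<dots> \<le> (\<Sum>s\<in>{s\<in>X. f s = i}. 1\<^sup>2) * (\<Sum>s\<in>{s\<in>X. f s = i}. (vec_index v (g s))\<^sup>2)"
        by (rule Cauchy_Schwarz_ineq_sum)
      also have "\<dots> \<le> a * (\<Sum>s\<in>{s\<in>X. f s = i}. (vec_index v (g s))\<^sup>2)"
        using fibre_le[of f a i, OF a] by (intro mult_right_mono sum_nonneg) auto
      finally show "(vec_index (A *\<^sub>v v) i)\<^sup>2
          \<le> a * (\<Sum>s\<in>{s\<in>X. f s = i}. (vec_index v (g s))\<^sup>2)" .
    qed
    also have "\<dots> = a * (\<Sum>s\<in>X. (vec_index v (g s))\<^sup>2)"
      unfolding sum_distrib_left[symmetric] using fin f by (subst sum.group) auto
    also have "(\<Sum>s\<in>X. (vec_index v (g s))\<^sup>2)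
        = (\<Sum>j<n. real (card {s\<in>X. g s = j}) * (vec_index v j)\<^sup>2)"
      using g by (rule sum_fibres[where h = "\<lambda>j. (vec_index v j)\<^sup>2"])
    also have "a * \<dots> \<le> a * (\<Sum>j<n. b * (vec_index v j)\<^sup>2)"
      using fibre_le[of g b, OF b] by (intro mult_left_mono sum_mono mult_right_mono) auto
    finally show ?thesis by (simp add: sum_distrib_left mult.assoc)
  qed
  \<comment> \<open>The nonzero columns of \<open>A\<close> are those in the range of
    \<open>g\<close>, and \<open>r\<close> squared is their number. The unit vector \<open>w\<close>
    is constant on them, so Cauchy-Schwarz is an equality on each fibre of \<open>f\<close>.\<close>
  define r where "r = sqrt (card (g ` X))"
  have r: "r > 0" using fin ne by (simp add: r_def card_gt_0_iff)
  define w where "w = Matrix.vec n (\<lambda>j. if j \<in> g ` X then 1 / r else 0)"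
  have w: "w \<in> carrier_vec n" by (simp add: w_def)
  \<comment> \<open>Counting \<open>X\<close> along \<open>f\<close> and along \<open>g\<close>
    relates the sizes of the two ranges.\<close>
  have uniform: "card X = c * card (k ` X)"
    if "\<And>s. s \<in> X \<Longrightarrow> card {x\<in>X. k x = k s} = c" for c and k :: "'a \<Rightarrow> nat"
  proof -
    have "(\<Sum>s\<in>X. 1::nat) = (\<Sum>j\<in>k ` X. \<Sum>s\<in>{s\<in>X. k s = j}. 1)"
      using fin by (intro sum.group[symmetric]) auto
    also have "\<dots> = (\<Sum>j\<in>k ` X. c)" using that by (intro sum.cong) auto
    finally show ?thesis by simp
  qed
  have sum_indicator: "(\<Sum>j<l. if j \<in> k ` X then c else 0) = real (card (k ` X)) * c"
    if "\<And>s. s \<in> X \<Longrightarrow> k s < l" for k and l :: nat and c :: real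
  proof -
    have "{..<l} \<inter> k ` X = k ` X" using that by blast
    then show ?thesis by (simp add: sum.If_cases)
  qed
  have norm_w: "euclidean_norm w = 1"
  proof -
    have "(\<Sum>j<n. (vec_index w j)\<^sup>2) = (\<Sum>j<n. if j \<in> g ` X then 1 / r\<^sup>2 else 0)"
      by (intro sum.cong) (auto simp: w_def power_divide)
    also have "\<dots> = real (card (g ` X)) * (1 / r\<^sup>2)"
      using g by (rule sum_indicator)
    also have "\<dots> = 1" using fin ne by (simp add: r_def)
    finally show ?thesis by (simp add: euclidean_norm_altdef w_def)
  qed
  have norm_Aw: "euclidean_norm (A *\<^sub>v w) = sqrt (a * b)"
  proof -
    have entry: "vec_index (A *\<^sub>v w) i = (if i \<in> f ` X then a / r else 0)" if "i < m" for i
    proof -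
      have "vec_index (A *\<^sub>v w) i = (\<Sum>s\<in>{s\<in>X. f s = i}. 1 / r)"
        unfolding Av[OF w that] using g by (intro sum.cong) (auto simp: w_def)
      also have "\<dots> = real (card {s\<in>X. f s = i}) / r" by simp
      also have "\<dots> = (if i \<in> f ` X then a / r else 0)"
        using a by (auto simp: card_eq_0_iff)
      finally show ?thesis .
    qed
    have "(\<Sum>i<m. (vec_index (A *\<^sub>v w) i)\<^sup>2) = (\<Sum>i<m. if i \<in> f ` X then (a / r)\<^sup>2 else 0)"
      by (intro sum.cong) (auto simp: entry)
    also have "\<dots> = real (card (f ` X)) * (a / r)\<^sup>2"
      using f by (rule sum_indicator)
    also have "\<dots> = a * real (a * card (f ` X)) / r\<^sup>2"
      by (simp add: power_divide power2_eq_square)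
    \<comment> \<open>Both sides equal \<open>card X\<close>; this brings in \<open>b\<close> and
      lets the normalisation \<open>r\<close> cancel.\<close>
    also have "real (a * card (f ` X)) = b * r\<^sup>2"
      using uniform[of f a] uniform[of g b] a b by (simp add: r_def flip: of_nat_mult)
    also have "a * (b * r\<^sup>2) / r\<^sup>2 = a * b" using r by simp
    finally show ?thesis by (simp add: euclidean_norm_altdef dA)
  qed
  \<comment> \<open>The bound is attained at \<open>w\<close>, so the supremum is a maximum.\<close>
  have "spectral_norm A = sqrt (a * b)"
    unfolding spectral_norm_def dA
  proof (rule cSup_eq_maximum)
    show "sqrt (a * b) \<in> {euclidean_norm (A *\<^sub>v v) |v. v \<in> carrier_vec n \<and> euclidean_norm v \<le> 1}"
      using w norm_w norm_Aw by (intro CollectI exI[of _ w]) auto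
  next
    fix x assume "x \<in> {euclidean_norm (A *\<^sub>v v) |v. v \<in> carrier_vec n \<and> euclidean_norm v \<le> 1}"
    then obtain v where v: "v \<in> carrier_vec n" "euclidean_norm v \<le> 1"
      and x: "x = euclidean_norm (A *\<^sub>v v)" by auto
    have "(\<Sum>j<n. (vec_index v j)\<^sup>2) \<le> 1"
      using v by (simp add: euclidean_norm_altdef)
    then have "real (a * b) * (\<Sum>j<n. (vec_index v j)\<^sup>2) \<le> real (a * b) * 1"
      by (intro mult_left_mono) auto
    with upper[OF v(1)] show "x \<le> sqrt (a * b)"
      by (simp add: x euclidean_norm_altdef dA)
  qed
  then show ?thesis by simp
qed

section \<open>Kronecker products of standard basis columns\<close>

text \<open>Positions start at 0, unlike in \<open>basis_col\<close>, so that Kronecker products act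
  on them by \<open>k * n + l\<close>.\<close>

definition unit_col :: "nat \<Rightarrow> nat \<Rightarrow> real mat" where
  "unit_col n k = mat n 1 (\<lambda>(i, j). if i = k then 1 else 0)"

lemma basis_col_eq_unit_col: "basis_col n s = unit_col n (s - 1)"
  by (rule eq_matI) (auto simp: basis_col_def unit_col_def mat_of_cols_def unit_vec_def)

lemma div_mod_less:
  fixes i m n :: nat
  assumes "i < m * n"
  shows "i div n < m" "i mod n < n"
proof -
  have "0 < n" using assms by (cases n) auto
  then show "i div n < m" "i mod n < n" using assms by (auto simp: less_mult_imp_div_less)
qed

lemma eq_radix_iff:
  fixes i k l n :: nat
  assumes "l < n"
  shows "i = k * n + l \<longleftrightarrow> i div n = k \<and> i mod n = l"
  using assms by auto

text \<open>Row \<open>i\<close> of the product reads row \<open>i div n\<close> of the left factor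
  and row \<open>i mod n\<close> of the right one; both entries are 1 exactly when \<open>k\<close>
  and \<open>l\<close> are the two digits of \<open>i\<close>.\<close>

lemma kron_unit_col:
  assumes "l < n"
  shows "unit_col m k \<otimes>\<^sub>K unit_col n l = unit_col (m * n) (k * n + l)"
proof (rule eq_matI)
  fix i j assume "i < dim_row (unit_col (m * n) (k * n + l))" "j < dim_col (unit_col (m * n) (k * n + l))"
  then have i: "i < m * n" and j: "j = 0" by (auto simp: unit_col_def)
  show "(unit_col m k \<otimes>\<^sub>K unit_col n l) $$ (i, j) = unit_col (m * n) (k * n + l) $$ (i, j)"
    using i j div_mod_less[OF i] eq_radix_iff[OF assms, of i k]
    by (auto simp: kron_def unit_col_def)
qed (auto simp: kron_def unit_col_def)

lemma kron_transpose: "transpose_mat A \<otimes>\<^sub>K transpose_mat B = transpose_mat (A \<otimes>\<^sub>K B)"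
  by (rule eq_matI) (auto simp: kron_def div_mod_less)

text \<open>Lets the column side of the flattening reuse the computation for the row side.\<close>

lemma kron_list_transpose:
  "kron_list (map (\<lambda>x. transpose_mat (F x)) L) = transpose_mat (kron_list (map F L))"
  by (induction L) (auto simp: kron_list_def kron_transpose)

text \<open>The divisions in \<open>kron\<close> are trivial here: by 1 on rows, and by
  \<open>n\<close> of some \<open>j < n\<close> on columns.\<close>

lemma kron_unit_col_transpose:
  assumes "i < m" "j < n"
  shows "(unit_col m k \<otimes>\<^sub>K transpose_mat (unit_col n l)) $$ (i, j)
    = (if k = i \<and> l = j then 1 else 0)"
  using assms by (auto simp: kron_def unit_col_def)

text \<open>The head is the most significant digit, as in the right-nested products of
  \<open>kron_list\<close>.\<close>

primrec radix :: "('a \<Rightarrow> nat) \<Rightarrow> ('a \<Rightarrow> nat) \<Rightarrow> 'a list \<Rightarrow> nat" where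
  "radix d k [] = 0"
| "radix d k (x # L) = k x * prod_list (map d L) + radix d k L"

lemma radix_less:
  assumes "\<And>x. x \<in> set L \<Longrightarrow> k x < d x"
  shows "radix d k L < prod_list (map d L)"
  using assms
proof (induction L)
  case (Cons x L)
  have "radix d k (x # L) < (k x + 1) * prod_list (map d L)" using Cons by simp
  also have "\<dots> \<le> d x * prod_list (map d L)"
    using Cons.prems[of x] by (intro mult_right_mono) auto
  finally show ?case by simp
qed simp

text \<open>Dividing by the product of the remaining bases recovers the leading digit as quotient
  and the code of the tail as remainder, because that code is smaller than the product.\<close>

lemma radix_eq_iff:
  assumes "\<And>x. x \<in> set L \<Longrightarrow> k x < d x" "\<And>x. x \<in> set L \<Longrightarrow> k' x < d x"
  shows "radix d k L = radix d k' L \<longleftrightarrow> (\<forall>x\<in>set L. k x = k' x)"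
  using assms
proof (induction L)
  case (Cons x L)
  have "radix d k L < prod_list (map d L)" "radix d k' L < prod_list (map d L)"
    using Cons.prems by (auto intro: radix_less)
  then have "radix d k (x # L) = radix d k' (x # L) \<longleftrightarrow> k x = k' x \<and> radix d k L = radix d k' L"
    using eq_radix_iff[of "radix d k' L" "prod_list (map d L)" "radix d k (x # L)" "k' x"] by auto
  with Cons show ?case by auto
qed simp

lemma kron_list_unit_col:
  assumes "\<And>x. x \<in> set L \<Longrightarrow> k x < d x"
  shows "kron_list (map (\<lambda>x. unit_col (d x) (k x)) L) = unit_col (prod_list (map d L)) (radix d k L)"
  using assms
proof (induction L)
  case Nil
  show ?case by (rule eq_matI) (auto simp: kron_list_def unit_col_def)
next
  case (Cons x L)
  have "radix d k L < prod_list (map d L)" using Cons.prems by (intro radix_less) auto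
  with Cons show ?case by (simp add: kron_list_def kron_unit_col)
qed

section \<open>The flattening\<close>

text \<open>Two levels of \<open>radix\<close> mirror the two levels of tensor products: within each
  tuple \<open>I t\<close>, then over \<open>t\<close> in increasing order. The
  \<open>s i - 1\<close> are zero-based digits.\<close>

definition code :: "(nat \<Rightarrow> nat) \<Rightarrow> (nat \<Rightarrow> nat list) \<Rightarrow> nat set \<Rightarrow> (nat \<Rightarrow> nat) \<Rightarrow> nat" where
  "code S I R s = radix (\<lambda>t. tuple_dim S (I t)) (\<lambda>t. radix S (\<lambda>i. s i - 1) (I t)) (sorted_list_of_set R)"

lemma multi_indices_bounds:
  assumes "s \<in> multi_indices p S" "u \<in> {1..p}"
  shows "1 \<le> s u" "s u \<le> S u" "s u - 1 < S u"
proof -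
  show "1 \<le> s u" "s u \<le> S u" using assms by (auto simp: multi_indices_def PiE_iff)
  then show "s u - 1 < S u" by simp
qed

context
  fixes p :: nat and S :: "nat \<Rightarrow> nat" and I :: "nat \<Rightarrow> nat list" and R :: "nat set"
  assumes fin: "finite R" and sub: "\<And>t. t \<in> R \<Longrightarrow> set (I t) \<subseteq> {1..p}"
begin

lemma radix_tuple_less:
  assumes "s \<in> multi_indices p S" "t \<in> R"
  shows "radix S (\<lambda>i. s i - 1) (I t) < tuple_dim S (I t)"
  unfolding tuple_dim_def
  using sub[OF assms(2)] by (intro radix_less multi_indices_bounds(3)[OF assms(1)]) auto

lemma prod_list_tuple_dim:
  "prod_list (map (\<lambda>t. tuple_dim S (I t)) (sorted_list_of_set R)) = (\<Prod>t\<in>R. tuple_dim S (I t))"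
  using fin prod.distinct_set_conv_list[of "sorted_list_of_set R" "\<lambda>t. tuple_dim S (I t)"] by simp

lemma code_less:
  assumes "s \<in> multi_indices p S"
  shows "code S I R s < (\<Prod>t\<in>R. tuple_dim S (I t))"
  unfolding code_def prod_list_tuple_dim[symmetric]
  using assms fin by (intro radix_less radix_tuple_less) auto

lemma kron_list_basis_tensor:
  assumes "s \<in> multi_indices p S"
  shows "kron_list (map (\<lambda>t. basis_tensor S (I t) s) (sorted_list_of_set R))
    = unit_col (\<Prod>t\<in>R. tuple_dim S (I t)) (code S I R s)"
proof -
  have "basis_tensor S (I t) s = unit_col (tuple_dim S (I t)) (radix S (\<lambda>i. s i - 1) (I t))"
    if "t \<in> R" for t
    unfolding basis_tensor_def basis_col_eq_unit_col tuple_dim_def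
    using sub[OF that] assms by (intro kron_list_unit_col multi_indices_bounds(3)) auto
  then have "map (\<lambda>t. basis_tensor S (I t) s) (sorted_list_of_set R)
      = map (\<lambda>t. unit_col (tuple_dim S (I t)) (radix S (\<lambda>i. s i - 1) (I t))) (sorted_list_of_set R)"
    using fin by simp
  then show ?thesis
    unfolding code_def prod_list_tuple_dim[symmetric]
    using fin by (simp only:) (intro kron_list_unit_col radix_tuple_less[OF assms], simp)
qed

text \<open>Uniqueness of digits applies at both levels. An index occurring in several tuples merely
  repeats the same condition.\<close>

lemma code_eq_iff:
  assumes s: "s \<in> multi_indices p S" and s': "s' \<in> multi_indices p S"
  shows "code S I R s = code S I R s' \<longleftrightarrow> (\<forall>u\<in>\<Union>t\<in>R. set (I t). s u = s' u)"
proof -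
  have "code S I R s = code S I R s'
      \<longleftrightarrow> (\<forall>t\<in>R. radix S (\<lambda>i. s i - 1) (I t) = radix S (\<lambda>i. s' i - 1) (I t))"
    unfolding code_def
    using fin radix_tuple_less[OF s] radix_tuple_less[OF s'] by (subst radix_eq_iff) simp_all
  also have "\<dots> \<longleftrightarrow> (\<forall>t\<in>R. \<forall>u\<in>set (I t). s u - 1 = s' u - 1)"
  proof (intro ball_cong refl)
    fix t assume "t \<in> R"
    from sub[OF this] show "(radix S (\<lambda>i. s i - 1) (I t) = radix S (\<lambda>i. s' i - 1) (I t))
        = (\<forall>u\<in>set (I t). s u - 1 = s' u - 1)"
      by (intro radix_eq_iff multi_indices_bounds(3)[OF s] multi_indices_bounds(3)[OF s']) auto
  qed
  \<comment> \<open>Truncated subtraction loses nothing, since all coordinates are at least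
    1.\<close>
  also have "\<dots> \<longleftrightarrow> (\<forall>t\<in>R. \<forall>u\<in>set (I t). s u = s' u)"
  proof (intro ball_cong refl)
    fix t u assume "t \<in> R" "u \<in> set (I t)"
    then have "u \<in> {1..p}" using sub by blast
    from multi_indices_bounds(1)[OF s this] multi_indices_bounds(1)[OF s' this]
    show "(s u - 1 = s' u - 1) = (s u = s' u)" by auto
  qed
  finally show ?thesis by auto
qed

text \<open>The code fixes the coordinates in the union of the tuples and leaves the others free, so
  the count does not depend on \<open>s\<close>.\<close>

lemma card_code_fibre:
  assumes s: "s \<in> multi_indices p S"
  shows "card {x \<in> multi_indices p S. code S I R x = code S I R s}
    = (\<Prod>u\<in>{1..p} - (\<Union>t\<in>R. set (I t)). S u)"
proof -
  let ?U = "\<Union>t\<in>R. set (I t)"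
  have "?U \<subseteq> {1..p}" using sub by auto
  have "{x \<in> multi_indices p S. code S I R x = code S I R s}
      = {x \<in> multi_indices p S. \<forall>u\<in>?U. x u = s u}"
    using code_eq_iff s by blast
  \<comment> \<open>Written as a product set with singleton factors at the fixed coordinates, the
    fibre is counted by \<open>card_PiE\<close>.\<close>
  also have "\<dots> = (\<Pi>\<^sub>E u\<in>{1..p}. if u \<in> ?U then {s u} else {1..S u})" (is "?L = ?P")
  proof (intro equalityI subsetI)
    fix x assume "x \<in> ?L"
    then show "x \<in> ?P" by (auto simp: multi_indices_def PiE_iff)
  next
    fix x assume x: "x \<in> ?P"
    have eq: "x u = s u" if "u \<in> ?U" for u
    proof -
      have "u \<in> {1..p}" using that \<open>?U \<subseteq> {1..p}\<close> by blast
      from PiE_mem[OF x this] that show ?thesis by (simp only: if_True singleton_iff)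
    qed
    have "x u \<in> {1..S u}" if "u \<in> {1..p}" for u
    proof (cases "u \<in> ?U")
      case True
      then show ?thesis using eq[OF True] multi_indices_bounds[OF s that] by simp
    next
      case False
      with PiE_mem[OF x that] show ?thesis by (simp only: if_False)
    qed
    then have "x \<in> multi_indices p S"
      using x unfolding multi_indices_def PiE_iff by blast
    with eq show "x \<in> ?L" by blast
  qed
  also have "card \<dots> = (\<Prod>u\<in>{1..p}. if u \<in> ?U then 1 else S u)"
    by (subst card_PiE) (auto intro!: prod.cong)
  also have "\<dots> = (\<Prod>u\<in>{1..p} - ?U. S u)"
    by (intro prod.mono_neutral_cong_right) auto
  finally show ?thesis .
qed

end

theorem proposition3p4:
  fixes M :: "'w measure" and \<xi> :: "'w \<Rightarrow> real" and h :: "nat \<Rightarrow> nat list \<Rightarrow> 'w \<Rightarrow> real"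
    and q p :: nat and S :: "nat \<Rightarrow> nat" and I :: "nat \<Rightarrow> nat list"
    and Y :: "'w \<Rightarrow> real mat" and R C :: "nat set"
  assumes "matrix_chaos_comb M \<xi> h q p S I Y"
    and "R \<subseteq> {1..q + 2}" and "C \<subseteq> {1..q + 2}"
  shows "(spectral_norm (flattening p S I R C))\<^sup>2 =
    real ((\<Prod>u\<in>{1..p} - (\<Union>t\<in>R. set (I t)). S u) * (\<Prod>u\<in>{1..p} - (\<Union>t\<in>C. set (I t)). S u))"
proof -
  have pos: "\<And>u. u \<in> {1..p} \<Longrightarrow> 0 < S u"
    and sub: "\<And>t. t \<in> {1..q + 2} \<Longrightarrow> set (I t) \<subseteq> {1..p}"
    using assms(1) by (auto simp: matrix_chaos_comb_def combinatorial_data_def)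
  have finR: "finite R" and finC: "finite C" using assms(2,3) by (auto intro: finite_subset)
  have subR: "\<And>t. t \<in> R \<Longrightarrow> set (I t) \<subseteq> {1..p}" and subC: "\<And>t. t \<in> C \<Longrightarrow> set (I t) \<subseteq> {1..p}"
    using sub assms(2,3) by blast+
  let ?m = "\<Prod>t\<in>R. tuple_dim S (I t)" and ?n = "\<Prod>t\<in>C. tuple_dim S (I t)"
  have finX: "finite (multi_indices p S)" by (auto simp: multi_indices_def intro!: finite_PiE)
  have neX: "multi_indices p S \<noteq> {}"
    using pos by (force simp: multi_indices_def PiE_eq_empty_iff Suc_le_eq)
  \<comment> \<open>Each summand is the matrix unit at the pair of codes for \<open>R\<close> and
    \<open>C\<close>, which play the parts of \<open>f\<close> and \<open>g\<close> in
    \<open>spectral_norm_fibres\<close>.\<close>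
  have "flattening p S I R C = mat ?m ?n (\<lambda>(i, j). \<Sum>s\<in>multi_indices p S.
      if code S I R s = i \<and> code S I C s = j then 1 else 0)"
    unfolding flattening_def mat_sum_def kron_list_transpose
    by (rule eq_matI)
      (auto intro!: sum.cong simp: kron_list_basis_tensor[OF finR subR]
        kron_list_basis_tensor[OF finC subC] kron_unit_col_transpose)
  also have "(spectral_norm \<dots>)\<^sup>2 =
      real ((\<Prod>u\<in>{1..p} - (\<Union>t\<in>R. set (I t)). S u) * (\<Prod>u\<in>{1..p} - (\<Union>t\<in>C. set (I t)). S u))"
    by (intro spectral_norm_fibres finX neX code_less[OF finR subR] code_less[OF finC subC]
        card_code_fibre[OF finR subR] card_code_fibre[OF finC subC])
  finally show ?thesis .
qed

end
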